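(* Let $\mathcal{P}=\{X_i\mid i\in I\}$ be a partition of a nonempty set $X$, let $E$ be the equivalence relation on $X$ induced by $\mathcal{P}$, and let $f\in T_{E^*}(X)$. Then $f$ is unit-regular in $T_{E^*}(X)$ if and only if both of the following hold: (i) $\chi^{(f)}\in\Gamma(I)$; (ii) whenever $i\chi^{(f)}=j$ (with $i,j\in I$), one has $|X_i|=|X_j|$ and $\mathrm{c}(f_i)=\mathrm{d}(f_i)$, where $f_i\in B(f,I)$.
   Context: Maps are written to the right of their arguments and composed from left to right; $Af$ denotes the image of $A$ under $f$. $X$ may be finite or infinite. A partition $\mathcal{P}=\{X_i\mid i\in I\}$ of $X$ is a collection of nonempty pairwise disjoint subsets (blocks) with union $X$, with distinct indices giving distinct blocks; $(x,y)\in E$ iff $x,y$ lie in the same block. $T(X)$ is the monoid of all selfmaps of $X$ under composition. $T(X,\mathcal{P})=\{f\in T(X)\mid (\forall X_i\in\mathcal{P})(\exists X_j\in\mathcal{P})\ X_if\subseteq X_j\}$, and $T_{E^*}(X)=\{f\in T(X)\mid (\forall x,y\in X)\ (x,y)\in E\Longleftrightarrow (xf,yf)\in E\}$, a submonoid of $T(X,\mathcal{P})$. An element $x$ of a monoid $M$ is unit-regular in $M$ if there is a unit $u$ of $M$ with $xux=x$. For $f\in T(X,\mathcal{P})$, the character $\chi^{(f)}\colon I\to I$ is defined by $i\chi^{(f)}=j$ whenever $X_if\subseteq X_j$. $\Gamma(I)$ is the monoid of all surjective maps $I\to I$. $B(f,I)=\{f_i\mid i\in I\}$, where $f_i\colon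 X_i\to X_{i\chi^{(f)}}$, $xf_i=xf$, is the map induced by $f$. For a map $h\colon A\to B$, the collapse is $\mathrm{c}(h)=|A\setminus T_h|$, where $T_h$ is any cross-section of $\ker(h)=\{(x,y)\in A\times A\mid xh=yh\}$ (a subset of $A$ meeting each class in exactly one point), and the defect is $\mathrm{d}(h)=|B\setminus Ah|$. *)

theory Defs
  imports "HOL-Algebra.Group" "HOL-Library.Disjoint_Sets"
begin

unbundle cardinal_syntax

text \<open>Selfmaps of a set \<open>X\<close> are extensional functions, so that HOL equality of maps is equality
  on \<open>X\<close>. Maps are written on the right: the product \<open>f \<otimes> g\<close> means ``first \<open>f\<close>, then \<open>g\<close>''.\<close>

definition trans_monoid :: "'a set \<Rightarrow> ('a \<Rightarrow> 'a) monoid"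
  where "trans_monoid X =
    \<lparr>carrier = X \<rightarrow>\<^sub>E X, mult = (\<lambda>f g. compose X g f), one = (\<lambda>x\<in>X. x)\<rparr>"

text \<open>Injectivity of the indexing says that distinct indices give distinct blocks.\<close>

definition indexed_partition :: "'a set \<Rightarrow> 'i set \<Rightarrow> ('i \<Rightarrow> 'a set) \<Rightarrow> bool"
  where "indexed_partition X I P \<longleftrightarrow> partition_on X (P ` I) \<and> inj_on P I"

definition block_rel :: "'i set \<Rightarrow> ('i \<Rightarrow> 'a set) \<Rightarrow> ('a \<times> 'a) set"
  where "block_rel I P = {(x, y). \<exists>i\<in>I. x \<in> P i \<and> y \<in> P i}"

definition T_part :: "'a set \<Rightarrow> 'i set \<Rightarrow> ('i \<Rightarrow> 'a set) \<Rightarrow> ('a \<Rightarrow> 'a) set"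
  where "T_part X I P =
    {f \<in> carrier (trans_monoid X). \<forall>i\<in>I. \<exists>j\<in>I. f ` P i \<subseteq> P j}"

definition T_Estar :: "'a set \<Rightarrow> ('a \<times> 'a) set \<Rightarrow> ('a \<Rightarrow> 'a) set"
  where "T_Estar X E =
    {f \<in> carrier (trans_monoid X). \<forall>x\<in>X. \<forall>y\<in>X. (x, y) \<in> E \<longleftrightarrow> (f x, f y) \<in> E}"

definition T_Estar_monoid :: "'a set \<Rightarrow> ('a \<times> 'a) set \<Rightarrow> ('a \<Rightarrow> 'a) monoid"
  where "T_Estar_monoid X E = (trans_monoid X)\<lparr>carrier := T_Estar X E\<rparr>"

definition unit_regular :: "('m, 'z) monoid_scheme \<Rightarrow> 'm \<Rightarrow> bool"
  where "unit_regular M x \<longleftrightarrow>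
    x \<in> carrier M \<and> (\<exists>u\<in>Units M. x \<otimes>\<^bsub>M\<^esub> u \<otimes>\<^bsub>M\<^esub> x = x)"

text \<open>The index \<open>j\<close> is unique for \<open>f \<in> T_part X I P\<close>; see \<open>character_eq_iff\<close> below.\<close>

definition character :: "'i set \<Rightarrow> ('i \<Rightarrow> 'a set) \<Rightarrow> ('a \<Rightarrow> 'a) \<Rightarrow> 'i \<Rightarrow> 'i"
  where "character I P f = (\<lambda>i\<in>I. THE j. j \<in> I \<and> f ` P i \<subseteq> P j)"

definition surj_maps :: "'i set \<Rightarrow> ('i \<Rightarrow> 'i) set"
  where "surj_maps I = {g \<in> I \<rightarrow>\<^sub>E I. g ` I = I}"

text \<open>The map \<open>f\<^sub>i\<close> from \<open>P i\<close> to \<open>P (character I P f i)\<close>. A HOL function does not carry its domain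
  and codomain, so these are separate arguments of \<open>collapse\<close> and \<open>defect\<close>.\<close>

definition block_map :: "('i \<Rightarrow> 'a set) \<Rightarrow> ('a \<Rightarrow> 'a) \<Rightarrow> 'i \<Rightarrow> 'a \<Rightarrow> 'a"
  where "block_map P f i = restrict f (P i)"

definition ker :: "'a set \<Rightarrow> ('a \<Rightarrow> 'b) \<Rightarrow> ('a \<times> 'a) set"
  where "ker A h = {(x, y) \<in> A \<times> A. h x = h y}"

definition cross_section :: "'a set \<Rightarrow> ('a \<Rightarrow> 'b) \<Rightarrow> 'a set \<Rightarrow> bool"
  where "cross_section A h T \<longleftrightarrow> T \<subseteq> A \<and> (\<forall>K \<in> A // ker A h. \<exists>!t. t \<in> T \<inter> K)"

text \<open>Cardinalities, possibly infinite, are the cardinals \<open>|A|\<close> of HOL, to be compared by \<open>=o\<close>.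
  The collapse does not depend on the chosen cross-section; see \<open>collapse_eq\<close> below.\<close>

definition collapse :: "'a set \<Rightarrow> ('a \<Rightarrow> 'b) \<Rightarrow> 'a rel"
  where "collapse A h = |A - (SOME T. cross_section A h T)|"

definition defect :: "'a set \<Rightarrow> 'b set \<Rightarrow> ('a \<Rightarrow> 'b) \<Rightarrow> 'b rel"
  where "defect A B h = |B - h ` A|"


lemma monoid_of_closed_set:
  assumes "S \<subseteq> X \<rightarrow>\<^sub>E X" "(\<lambda>x\<in>X. x) \<in> S" "\<And>f g. f \<in> S \<Longrightarrow> g \<in> S \<Longrightarrow> compose X g f \<in> S"
  shows "monoid ((trans_monoid X)\<lparr>carrier := S\<rparr>)"
proof (rule monoidI, simp_all add: trans_monoid_def assms(2,3))
  fix f g h assume "f \<in> S" "g \<in> S" "h \<in> S"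
  then have f: "f \<in> X \<rightarrow> X"
    using assms(1) by blast
  then show "compose X h (compose X g f) = compose X (compose X h g) f"
    by (rule compose_assoc)
next
  fix f assume "f \<in> S"
  then have "f \<in> X \<rightarrow> X" "f \<in> extensional X"
    using assms(1) by (auto simp: PiE_def)
  then show "compose X f (\<lambda>x\<in>X. x) = f" "compose X (\<lambda>x\<in>X. x) f = f"
    using compose_Id[of f X X] Id_compose[of f X X] by simp_all
qed

lemma monoid_trans_monoid: "monoid (trans_monoid X)"
proof -
  have "monoid ((trans_monoid X)\<lparr>carrier := X \<rightarrow>\<^sub>E X\<rparr>)"
    by (rule monoid_of_closed_set) (auto simp: compose_def)
  then show ?thesis
    by (simp add: trans_monoid_def)
qed

lemma monoid_T_Estar_monoid: "monoid (T_Estar_monoid X E)"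
  unfolding T_Estar_monoid_def
proof (rule monoid_of_closed_set)
  show "T_Estar X E \<subseteq> X \<rightarrow>\<^sub>E X"
    by (auto simp: T_Estar_def trans_monoid_def)
  show "(\<lambda>x\<in>X. x) \<in> T_Estar X E"
    by (simp add: T_Estar_def trans_monoid_def)
next
  fix f g assume fg: "f \<in> T_Estar X E" "g \<in> T_Estar X E"
  have X: "f x \<in> X" "g x \<in> X" if "x \<in> X" for x
    using fg that by (auto simp: T_Estar_def trans_monoid_def)
  have "(x, y) \<in> E \<longleftrightarrow> (g (f x), g (f y)) \<in> E" if "x \<in> X" "y \<in> X" for x y
  proof -
    have "(x, y) \<in> E \<longleftrightarrow> (f x, f y) \<in> E"
      using fg(1) that unfolding T_Estar_def by blast
    also have "\<dots> \<longleftrightarrow> (g (f x), g (f y)) \<in> E"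
      using fg(2) X(1)[OF that(1)] X(1)[OF that(2)] unfolding T_Estar_def by blast
    finally show ?thesis .
  qed
  moreover have "compose X g f \<in> X \<rightarrow>\<^sub>E X"
    using X by (simp add: compose_def)
  ultimately show "compose X g f \<in> T_Estar X E"
    unfolding T_Estar_def trans_monoid_def by (simp add: compose_eq)
qed

lemma indexed_partition_unique:
  assumes "indexed_partition X I P" "i \<in> I" "j \<in> I" "x \<in> P i" "x \<in> P j"
  shows "i = j"
proof -
  have "P i = P j"
  proof (rule ccontr)
    assume "P i \<noteq> P j"
    then have "P i \<inter> P j = {}"
      using assms(1-3) disjointD[of "P ` I" "P i" "P j"]
      by (simp add: indexed_partition_def partition_on_def)
    then show False
      using assms(4,5) by blast
  qed
  then show ?thesis
    using assms(1-3) unfolding indexed_partition_def by (meson inj_onD)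
qed

lemma indexed_partition_cover:
  assumes "indexed_partition X I P"
  shows "X = (\<Union>i\<in>I. P i)"
  using assms by (simp add: indexed_partition_def partition_on_def)

lemma indexed_partition_nonempty:
  assumes "indexed_partition X I P" "i \<in> I"
  obtains x where "x \<in> P i"
proof -
  have "{} \<notin> P ` I"
    using assms(1) by (simp add: indexed_partition_def partition_on_def)
  then have "P i \<noteq> {}"
    using assms(2) by force
  then show thesis
    using that by blast
qed

lemma equiv_block_rel:
  assumes "indexed_partition X I P"
  shows "equiv X (block_rel I P)"
proof -
  have X: "X = (\<Union>i\<in>I. P i)"
    by (rule indexed_partition_cover[OF assms])
  show ?thesis
  proof (rule equivI)
    show "block_rel I P \<subseteq> X \<times> X"
      by (auto simp: X block_rel_def)
    show "refl_on X (block_rel I P)"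
      by (rule refl_onI) (auto simp: X block_rel_def)
    show "sym (block_rel I P)"
      by (auto simp: block_rel_def sym_def)
    show "trans (block_rel I P)"
    proof (rule transI)
      fix x y z assume "(x, y) \<in> block_rel I P" "(y, z) \<in> block_rel I P"
      then obtain i j where ij: "i \<in> I" "x \<in> P i" "y \<in> P i" "j \<in> I" "y \<in> P j" "z \<in> P j"
        unfolding block_rel_def by blast
      then have "i = j"
        using indexed_partition_unique[OF assms] by blast
      then show "(x, z) \<in> block_rel I P"
        using ij unfolding block_rel_def by blast
    qed
  qed
qed

lemma T_Estar_subset_T_part:
  assumes "indexed_partition X I P"
  shows "T_Estar X (block_rel I P) \<subseteq> T_part X I P"
proof
  fix f assume f: "f \<in> T_Estar X (block_rel I P)"
  have X: "X = (\<Union>i\<in>I. P i)"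
    by (rule indexed_partition_cover[OF assms])
  have "\<exists>j\<in>I. f ` P i \<subseteq> P j" if i: "i \<in> I" for i
  proof -
    obtain x where x: "x \<in> P i"
      using indexed_partition_nonempty[OF assms i] .
    then have "x \<in> X"
      using i X by blast
    then have "f x \<in> X"
      using f by (auto simp: T_Estar_def trans_monoid_def)
    then obtain j where j: "j \<in> I" "f x \<in> P j"
      using X by blast
    have "f y \<in> P j" if y: "y \<in> P i" for y
    proof -
      have "(f x, f y) \<in> block_rel I P"
      proof -
        have "(x, y) \<in> block_rel I P" "x \<in> X" "y \<in> X"
          using x y i X unfolding block_rel_def by blast+
        then show ?thesis
          using f by (simp add: T_Estar_def)
      qed
      then obtain k where k: "k \<in> I" "f x \<in> P k" "f y \<in> P k"
        unfolding block_rel_def by blast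
      then have "k = j"
        using indexed_partition_unique[OF assms _ j(1) _ j(2)] by blast
      then show ?thesis
        using k by blast
    qed
    then show ?thesis using j by blast
  qed
  then show "f \<in> T_part X I P"
    using f by (simp add: T_part_def T_Estar_def)
qed

lemma character_eq_iff:
  assumes "indexed_partition X I P" "f \<in> T_part X I P" "i \<in> I" "j \<in> I"
  shows "character I P f i = j \<longleftrightarrow> f ` P i \<subseteq> P j"
proof -
  obtain x where x: "x \<in> P i"
    using indexed_partition_nonempty[OF assms(1,3)] .
  obtain k where k: "k \<in> I" "f ` P i \<subseteq> P k"
    using assms by (auto simp: T_part_def)
  have uniq: "l = k" if "l \<in> I" "f ` P i \<subseteq> P l" for l
  proof -
    have "f x \<in> P l" "f x \<in> P k"
      using that k x by blast+
    then show ?thesis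
      using indexed_partition_unique[OF assms(1) that(1) k(1)] by blast
  qed
  have "(THE j. j \<in> I \<and> f ` P i \<subseteq> P j) = k"
    using k uniq by (intro the_equality) blast+
  then have "character I P f i = k"
    using assms(3) by (simp add: character_def)
  then show ?thesis
    using k uniq assms(4) by blast
qed

lemma cross_section_iff:
  "cross_section A h T \<longleftrightarrow> T \<subseteq> A \<and> (\<forall>x\<in>A. \<exists>!t. t \<in> T \<and> h t = h x)"
proof -
  have *: "(t \<in> T \<inter> ker A h `` {x}) = (t \<in> T \<and> h t = h x)" if "T \<subseteq> A" "x \<in> A" for t x
    using that by (auto simp: ker_def)
  have **: "(\<forall>K \<in> A // ker A h. Q K) = (\<forall>x\<in>A. Q (ker A h `` {x}))" for Q
    unfolding quotient_def by simp
  show ?thesis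
    unfolding cross_section_def ** by (intro conj_cong ball_cong refl) (simp only: *)
qed

lemma cross_section_exists: "\<exists>T. cross_section A h T"
proof
  show "cross_section A h (inv_into A h ` h ` A)"
    unfolding cross_section_iff
  proof (intro conjI ballI ex1I)
    show "inv_into A h ` h ` A \<subseteq> A"
      by (auto intro: inv_into_into)
  next
    fix x assume x: "x \<in> A"
    then show "inv_into A h (h x) \<in> inv_into A h ` h ` A"
      by simp
    show "h (inv_into A h (h x)) = h x"
      using x by (simp add: f_inv_into_f)
  next
    fix x t assume "x \<in> A" "t \<in> inv_into A h ` h ` A \<and> h t = h x"
    then show "t = inv_into A h (h x)"
      by (auto simp: f_inv_into_f)
  qed
qed

lemma cross_section_card_unique:
  assumes T: "cross_section A h T" and T': "cross_section A h T'"
  shows "|A - T| =o |A - T'|"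
proof -
  define r where "r = (\<lambda>S x. THE t. t \<in> S \<and> h t = h x)"
  have r: "r S x \<in> S \<and> h (r S x) = h x" if "cross_section A h S" "x \<in> A" for S x
    using that theI'[of "\<lambda>t. t \<in> S \<and> h t = h x"] unfolding cross_section_iff r_def by blast
  have eq: "s = t" if "cross_section A h S" "s \<in> S" "t \<in> S" "h s = h t" for S s t
    using that unfolding cross_section_iff by (metis subsetD)
  define g where "g = (\<lambda>S S' x. if x \<in> S' then r S x else x)"
  have g: "g S S' a \<in> A - S' \<and> g S' S (g S S' a) = a"
    if S: "cross_section A h S" and S': "cross_section A h S'" and a: "a \<in> A - S" for S S' a
  proof (cases "a \<in> S'")
    case True
    have b: "r S a \<in> S" "h (r S a) = h a"
      using r[OF S, of a] a by auto
    have bA: "r S a \<in> A"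
      using b S by (auto simp: cross_section_iff)
    have bS': "r S a \<notin> S'"
      using eq[OF S' _ True, of "r S a"] b a by (metis DiffD2)
    have "r S' (r S a) = a"
      using r[OF S' bA] eq[OF S' _ True, of "r S' (r S a)"] b by metis
    then show ?thesis
      using True b bA bS' by (simp add: g_def)
  next
    case False
    then show ?thesis using a by (simp add: g_def)
  qed
  have "bij_betw (g T T') (A - T) (A - T')"
    by (rule bij_betw_byWitness[where f' = "g T' T"])
       (use g[OF T T'] g[OF T' T] in auto)
  then show ?thesis
    using card_of_ordIso by blast
qed

lemma collapse_eq:
  assumes "cross_section A h T"
  shows "collapse A h =o |A - T|"
  unfolding collapse_def
  using cross_section_card_unique[OF someI_ex[OF cross_section_exists] assms] .

end

(* A unit u with f u f = f must carry the block containing f(x) bijectively onto the block of x, so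
   it amounts to an inverse of the (injective) character of f together with a bijection P j -> P i
   for every i with image j under the character, which is a generalized inverse of f_i.  A single
   map h: A -> B has a bijective generalized inverse u: B -> A iff c(h) = d(h): u maps h(A) onto a
   cross-section of ker h, and B - h(A) onto its complement. *)
theory Submission
  imports Defs
begin

section \<open>Bijective generalized inverses of a single map\<close>

lemma bij_generalized_inverse_iff_collapse_eq_defect:
  assumes h: "h ` A \<subseteq> B"
  shows "(\<exists>u. bij_betw u B A \<and> (\<forall>x\<in>A. h (u (h x)) = h x)) \<longleftrightarrow> collapse A h =o defect A B h"
proof
  assume "\<exists>u. bij_betw u B A \<and> (\<forall>x\<in>A. h (u (h x)) = h x)"
  then obtain u where u: "bij_betw u B A" and huh: "\<And>x. x \<in> A \<Longrightarrow> h (u (h x)) = h x"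
    by blast
  have inj: "inj_on u B" and img: "u ` B = A"
    using u by (auto simp: bij_betw_def)
  \<comment> \<open>The point \<open>u (h x)\<close> represents the kernel class of
    \<open>x\<close>. It is the only candidate: if \<open>t = u (h z)\<close> has
    \<open>h t = h x\<close>, then \<open>h z = h t = h x\<close>, whence
    \<open>t = u (h x)\<close>.\<close>
  have "cross_section A h (u ` h ` A)"
    unfolding cross_section_iff
  proof (intro conjI ballI ex1I)
    show "u ` h ` A \<subseteq> A"
      using h img by blast
    show "u (h x) \<in> u ` h ` A" "h (u (h x)) = h x" if "x \<in> A" for x
      using that huh by auto
    show "t = u (h x)" if "x \<in> A" "t \<in> u ` h ` A \<and> h t = h x" for x t
      using that huh by auto
  qed
  then have "collapse A h =o |A - u ` h ` A|"
    by (rule collapse_eq)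
  also have "A - u ` h ` A = u ` (B - h ` A)"
    using inj_on_image_set_diff[OF inj _ h, of B] img by auto
  also have "|u ` (B - h ` A)| =o |B - h ` A|"
    using card_of_ordIsoI[OF inj_on_imp_bij_betw[OF inj_on_subset[OF inj Diff_subset]]]
    by (rule ordIso_symmetric)
  finally show "collapse A h =o defect A B h"
    by (simp add: defect_def)
next
  assume cd: "collapse A h =o defect A B h"
  obtain T where T: "cross_section A h T"
    using cross_section_exists by blast
  have TA: "T \<subseteq> A" and T1: "\<And>x. x \<in> A \<Longrightarrow> \<exists>!t. t \<in> T \<and> h t = h x"
    using T by (auto simp: cross_section_iff)
  \<comment> \<open>A cross-section picks one point over each value of \<open>h\<close>; the inverse
    of this bijection is the part of \<open>u\<close> on the image of \<open>h\<close>.\<close>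
  have "bij_betw h T (h ` A)"
    unfolding bij_betw_def
  proof (intro conjI inj_onI)
    show "x = y" if "x \<in> T" "y \<in> T" "h x = h y" for x y
      using that T1[OF subsetD[OF TA that(1)]] by metis
    show "h ` T = h ` A"
    proof (rule equalityI[OF image_mono[OF TA] image_subsetI])
      fix x assume "x \<in> A"
      then obtain t where "t \<in> T" "h t = h x"
        using T1 by blast
      then show "h x \<in> h ` T"
        by (metis imageI)
    qed
  qed
  then have v: "bij_betw (inv_into T h) (h ` A) T" and hv: "\<And>y. y \<in> h ` A \<Longrightarrow> h (inv_into T h y) = y"
    by (rule bij_betw_inv_into, rule bij_betw_inv_into_right)
  have "|A - T| =o |B - h ` A|"
    using ordIso_transitive[OF ordIso_symmetric[OF collapse_eq[OF T]] cd] by (simp add: defect_def)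
  then obtain w where w: "bij_betw w (B - h ` A) (A - T)"
    using card_of_ordIso ordIso_symmetric by blast
  \<comment> \<open>On the image \<open>u\<close> is forced up to the choice of \<open>T\<close>;
    off the image any bijection \<open>w\<close> onto \<open>A - T\<close> will do, and equality of
    collapse and defect supplies one.\<close>
  define u where "u y = (if y \<in> h ` A then inv_into T h y else w y)" for y
  have "bij_betw u (h ` A \<union> (B - h ` A)) (T \<union> (A - T))"
    unfolding u_def by (rule bij_betw_disjoint_Un[OF v w]) auto
  then have "bij_betw u B A"
    using h TA by (simp add: Un_absorb1)
  moreover have "\<forall>x\<in>A. h (u (h x)) = h x"
    using hv by (simp add: u_def)
  ultimately show "\<exists>u. bij_betw u B A \<and> (\<forall>x\<in>A. h (u (h x)) = h x)"
    by blast
qed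

section \<open>Units and unit-regularity for maps that preserve and reflect E\<close>

lemma block_rel_iff:
  assumes "indexed_partition X I P" "i \<in> I" "j \<in> I" "x \<in> P i" "y \<in> P j"
  shows "(x, y) \<in> block_rel I P \<longleftrightarrow> i = j"
  using assms indexed_partition_unique[OF assms(1)] unfolding block_rel_def by blast

lemma T_EstarD:
  assumes "f \<in> T_Estar X E"
  shows "x \<in> X \<Longrightarrow> f x \<in> X"
    and "x \<in> X \<Longrightarrow> y \<in> X \<Longrightarrow> (f x, f y) \<in> E \<longleftrightarrow> (x, y) \<in> E"
  using assms by (auto simp: T_Estar_def trans_monoid_def)

text \<open>Since membership in \<open>T_Estar\<close> is an equivalence and not just an
  implication, it passes from a bijection to its inverse.\<close>

lemma Units_T_Estar_monoid_iff:
  "u \<in> Units (T_Estar_monoid X E) \<longleftrightarrow> u \<in> T_Estar X E \<and> bij_betw u X X"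
proof
  assume "u \<in> Units (T_Estar_monoid X E)"
  then obtain v where u: "u \<in> T_Estar X E" and v: "v \<in> T_Estar X E"
    and eq: "compose X u v = (\<lambda>x\<in>X. x)" "compose X v u = (\<lambda>x\<in>X. x)"
    by (auto simp: Units_def T_Estar_monoid_def trans_monoid_def)
  have "u (v x) = x" "v (u x) = x" if "x \<in> X" for x
    using that fun_cong[OF eq(1), of x] fun_cong[OF eq(2), of x] by (simp_all add: compose_def)
  then have "bij_betw u X X"
    using T_EstarD(1)[OF u] T_EstarD(1)[OF v] by (intro bij_betw_byWitness[where f' = v]) auto
  with u show "u \<in> T_Estar X E \<and> bij_betw u X X" ..
next
  assume "u \<in> T_Estar X E \<and> bij_betw u X X"
  then have u: "u \<in> T_Estar X E" and bij: "bij_betw u X X"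
    by auto
  \<comment> \<open>The restriction makes \<open>v\<close> extensional, as the carrier
    demands.\<close>
  define v where "v = (\<lambda>x\<in>X. inv_into X u x)"
  have vX: "v x \<in> X" and uv: "u (v x) = x" and vu: "v (u x) = x" if "x \<in> X" for x
    using that bij T_EstarD(1)[OF u that]
    by (auto simp: v_def bij_betw_def f_inv_into_f inv_into_into)
  have "(x, y) \<in> E \<longleftrightarrow> (v x, v y) \<in> E" if "x \<in> X" "y \<in> X" for x y
    using T_EstarD(2)[OF u vX vX, OF that] that by (simp add: uv)
  moreover have "v \<in> X \<rightarrow>\<^sub>E X"
    using vX by (auto simp: v_def)
  ultimately have "v \<in> T_Estar X E"
    by (simp add: T_Estar_def trans_monoid_def)
  moreover have "compose X u v = (\<lambda>x\<in>X. x)" "compose X v u = (\<lambda>x\<in>X. x)"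
    by (auto simp: compose_def fun_eq_iff uv vu)
  ultimately show "u \<in> Units (T_Estar_monoid X E)"
    using u by (auto simp: Units_def T_Estar_monoid_def trans_monoid_def)
qed

lemma unit_regular_T_Estar_iff:
  assumes f: "f \<in> T_Estar X E"
  shows "unit_regular (T_Estar_monoid X E) f \<longleftrightarrow>
    (\<exists>u\<in>T_Estar X E. bij_betw u X X \<and> (\<forall>x\<in>X. f (u (f x)) = f x))"
proof -
  have "f \<otimes>\<^bsub>T_Estar_monoid X E\<^esub> u \<otimes>\<^bsub>T_Estar_monoid X E\<^esub> f = f \<longleftrightarrow> (\<forall>x\<in>X. f (u (f x)) = f x)" for u
  proof -
    \<comment> \<open>Off \<open>X\<close> both sides of the equation of maps take the value
      \<open>undefined\<close>, so only the points of \<open>X\<close> matter.\<close>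
    have ext: "f x = undefined" if "x \<notin> X" for x
      using f that by (auto simp: T_Estar_def trans_monoid_def extensional_def PiE_def)
    show ?thesis
      unfolding T_Estar_monoid_def trans_monoid_def fun_eq_iff compose_def
      by (simp add: ext restrict_def) (use ext in metis)
  qed
  moreover have "f \<in> carrier (T_Estar_monoid X E)"
    using f by (simp add: T_Estar_monoid_def)
  ultimately show ?thesis
    by (auto simp: unit_regular_def Units_T_Estar_monoid_iff)
qed

section \<open>The character and the reduction to blocks\<close>

lemma character_props:
  assumes P: "indexed_partition X I P" and f: "f \<in> T_Estar X (block_rel I P)"
  shows "character I P f \<in> I \<rightarrow>\<^sub>E I"
    and "inj_on (character I P f) I"
    and "i \<in> I \<Longrightarrow> x \<in> P i \<Longrightarrow> f x \<in> P (character I P f i)"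
proof -
  let ?c = "character I P f"
  have fT: "f \<in> T_part X I P"
    using T_Estar_subset_T_part[OF P] f by blast
  have cI: "?c i \<in> I" if "i \<in> I" for i
  proof -
    have "\<exists>j\<in>I. f ` P i \<subseteq> P j"
      using fT that by (simp add: T_part_def)
    then obtain j where j: "j \<in> I" "f ` P i \<subseteq> P j" ..
    then have "?c i = j"
      using character_eq_iff[OF P fT that j(1)] by blast
    then show ?thesis
      using j by simp
  qed
  moreover have "?c \<in> extensional I"
    by (simp add: character_def)
  ultimately show "?c \<in> I \<rightarrow>\<^sub>E I"
    by (simp add: PiE_def)
  show fP: "f x \<in> P (?c i)" if "i \<in> I" "x \<in> P i" for i x
    using character_eq_iff[OF P fT that(1) cI[OF that(1)]] that by blast
  \<comment> \<open>This uses that \<open>f\<close> reflects E: points of two blocks sent into a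
    common block have related images, so they were related already.\<close>
  show "inj_on ?c I"
  proof (rule inj_onI)
    fix i j assume ij: "i \<in> I" "j \<in> I" "?c i = ?c j"
    obtain x y where xy: "x \<in> P i" "y \<in> P j"
      using indexed_partition_nonempty[OF P] ij by metis
    then have "(f x, f y) \<in> block_rel I P"
      using block_rel_iff[OF P cI[OF ij(1)] cI[OF ij(2)] fP fP] ij by blast
    moreover have "x \<in> X" "y \<in> X"
      using xy ij indexed_partition_cover[OF P] by auto
    ultimately show "i = j"
      using T_EstarD(2)[OF f] block_rel_iff[OF P ij(1,2) xy] by blast
  qed
qed

text \<open>Once \<open>c\<close> is a bijection of \<open>I\<close>, the sets
  \<open>P (c i)\<close> run through all blocks exactly once. A global \<open>u\<close> then
  restricts to maps from \<open>P (c i)\<close> to \<open>P i\<close>, and such maps glue to a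
  global one.\<close>

lemma unit_regular_T_Estar_iff_blockwise:
  assumes P: "indexed_partition X I P" and f: "f \<in> T_Estar X (block_rel I P)"
  defines "c \<equiv> character I P f"
  shows "unit_regular (T_Estar_monoid X (block_rel I P)) f \<longleftrightarrow>
    c \<in> surj_maps I \<and>
    (\<forall>i\<in>I. \<exists>u. bij_betw u (P (c i)) (P i) \<and> (\<forall>x\<in>P i. f (u (f x)) = f x))"
    (is "?L \<longleftrightarrow> ?R")
proof -
  note cPi = character_props(1)[OF P f, folded c_def]
    and inj = character_props(2)[OF P f, folded c_def]
    and fP = character_props(3)[OF P f, folded c_def]
  have cI: "c i \<in> I" if "i \<in> I" for i
    using cPi that by blast
  have X: "X = (\<Union>i\<in>I. P i)"
    by (rule indexed_partition_cover[OF P])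
  show ?thesis
  proof
    assume ?L
    then obtain u where u: "u \<in> T_Estar X (block_rel I P)" and bij: "bij_betw u X X"
      and fuf: "\<And>x. x \<in> X \<Longrightarrow> f (u (f x)) = f x"
      unfolding unit_regular_T_Estar_iff[OF f] by blast
    have uX: "u x \<in> X" and fX: "f x \<in> X" if "x \<in> X" for x
      using T_EstarD(1)[OF u that] T_EstarD(1)[OF f that] by auto
    \<comment> \<open>The reference point is \<open>f x\<close> with \<open>x\<close> in
      \<open>P i\<close>. If \<open>u (f x)\<close> lies in \<open>P l\<close>, then
      \<open>f (u (f x)) = f x\<close> forces \<open>c l = c i\<close>, so \<open>l = i\<close> by
      injectivity. Any other \<open>y\<close> is compared with \<open>f x\<close> through E, which
      \<open>u\<close> preserves and reflects.\<close>
    have key: "u y \<in> P i \<longleftrightarrow> y \<in> P (c i)" if i: "i \<in> I" and y: "y \<in> X" for i y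
    proof -
      obtain x where x: "x \<in> P i"
        using indexed_partition_nonempty[OF P i] .
      then have xX: "x \<in> X"
        using i X by blast
      obtain j where j: "j \<in> I" "y \<in> P j"
        using y X by blast
      obtain k where k: "k \<in> I" "u y \<in> P k"
        using uX[OF y] X by blast
      obtain l where l: "l \<in> I" "u (f x) \<in> P l"
        using uX[OF fX[OF xX]] X by blast
      have "c l = c i"
        using indexed_partition_unique[OF P cI cI fP, OF l(1) i l] fP[OF i x] fuf[OF xX] by simp
      then have li: "l = i"
        using inj l i by (auto dest: inj_onD)
      have "u y \<in> P i \<longleftrightarrow> k = i"
        using indexed_partition_unique[OF P k(1) i k(2)] k by blast
      also have "\<dots> \<longleftrightarrow> (u y, u (f x)) \<in> block_rel I P"
        using block_rel_iff[OF P k(1) l(1) k(2) l(2)] li by simp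
      also have "\<dots> \<longleftrightarrow> (y, f x) \<in> block_rel I P"
        by (rule T_EstarD(2)[OF u y fX[OF xX]])
      also have "\<dots> \<longleftrightarrow> j = c i"
        by (rule block_rel_iff[OF P j(1) cI[OF i] j(2) fP[OF i x]])
      also have "\<dots> \<longleftrightarrow> y \<in> P (c i)"
        using indexed_partition_unique[OF P j(1) cI[OF i] j(2)] j by blast
      finally show ?thesis .
    qed
    \<comment> \<open>The preimage of \<open>j\<close> under \<open>c\<close> is the index of the
      block into which \<open>u\<close> sends a point of \<open>P j\<close>.\<close>
    have "j \<in> c ` I" if j: "j \<in> I" for j
    proof -
      obtain y where y: "y \<in> P j"
        using indexed_partition_nonempty[OF P j] .
      then have yX: "y \<in> X"
        using j X by blast
      obtain i where i: "i \<in> I" "u y \<in> P i"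
        using uX[OF yX] X by blast
      then have "y \<in> P (c i)"
        using key yX by blast
      then have "j = c i"
        using indexed_partition_unique[OF P j cI[OF i(1)] y] by blast
      then show ?thesis
        using i by blast
    qed
    then have "c \<in> surj_maps I"
      using cPi cI by (auto simp: surj_maps_def)
    moreover have "bij_betw u (P (c i)) (P i) \<and> (\<forall>x\<in>P i. f (u (f x)) = f x)" if i: "i \<in> I" for i
    proof -
      have sub: "P i \<subseteq> X" "P (c i) \<subseteq> X"
        using i cI[OF i] X by blast+
      have "u ` P (c i) = P i"
      proof
        show "u ` P (c i) \<subseteq> P i"
          using key[OF i] sub by blast
        \<comment> \<open>Each point of \<open>P i\<close> has a preimage under \<open>u\<close>
          somewhere in \<open>X\<close>, and \<open>key\<close> locates it in
          \<open>P (c i)\<close>.\<close>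
        have "P i \<subseteq> u ` X"
          using bij sub by (simp add: bij_betw_def)
        then show "P i \<subseteq> u ` P (c i)"
          using key[OF i] by blast
      qed
      then show ?thesis
        using bij_betw_subset[OF bij sub(2)] fuf sub by blast
    qed
    ultimately show ?R
      by blast
  next
    assume ?R
    then have c: "c ` I = I"
      and "\<forall>i\<in>I. \<exists>u. bij_betw u (P (c i)) (P i) \<and> (\<forall>x\<in>P i. f (u (f x)) = f x)"
      by (auto simp: surj_maps_def)
    then obtain h where h: "\<And>i. i \<in> I \<Longrightarrow> bij_betw (h i) (P (c i)) (P i)"
      and fhf: "\<And>i x. i \<in> I \<Longrightarrow> x \<in> P i \<Longrightarrow> f (h i (f x)) = f x"
      by metis
    \<comment> \<open>The local inverses \<open>h i\<close> are glued along the blocks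
      \<open>P (c i)\<close>: the index exists because \<open>c\<close> is onto and is unique
      because \<open>c\<close> is injective.\<close>
    define u where "u = (\<lambda>y\<in>X. h (THE i. i \<in> I \<and> y \<in> P (c i)) y)"
    have cover: "\<exists>i\<in>I. y \<in> P (c i)" if "y \<in> X" for y
      using that X c by (metis UN_iff imageE)
    have u: "u y = h i y" if i: "i \<in> I" and y: "y \<in> P (c i)" for i y
    proof -
      have "(THE i. i \<in> I \<and> y \<in> P (c i)) = i"
        using i y indexed_partition_unique[OF P cI cI] inj
        by (intro the_equality) (auto dest: inj_onD)
      moreover have "y \<in> X"
        using y cI[OF i] X by blast
      ultimately show ?thesis
        by (simp add: u_def)
    qed
    have uP: "u y \<in> P i" if "i \<in> I" "y \<in> P (c i)" for i y
      using u[OF that] h[OF that(1)] that(2) by (auto simp: bij_betw_def)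
    \<comment> \<open>As \<open>u\<close> moves \<open>P (c i)\<close> into \<open>P i\<close>, it
      acts on indices as the inverse of \<open>c\<close>; injectivity of that action makes
      \<open>u\<close> reflect E.\<close>
    have E: "(x, y) \<in> block_rel I P \<longleftrightarrow> (u x, u y) \<in> block_rel I P" if "x \<in> X" "y \<in> X" for x y
    proof -
      obtain i j where ij: "i \<in> I" "x \<in> P (c i)" "j \<in> I" "y \<in> P (c j)"
        using cover \<open>x \<in> X\<close> \<open>y \<in> X\<close> by blast
      have "(x, y) \<in> block_rel I P \<longleftrightarrow> c i = c j"
        using block_rel_iff[OF P cI cI] ij by blast
      also have "\<dots> \<longleftrightarrow> i = j"
        using inj ij by (auto dest: inj_onD)
      also have "\<dots> \<longleftrightarrow> (u x, u y) \<in> block_rel I P"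
        using block_rel_iff[OF P ij(1,3) uP uP] ij by blast
      finally show ?thesis .
    qed
    have uX: "u y \<in> X" if "y \<in> X" for y
      using cover[OF that] uP X by blast
    moreover have "u \<in> extensional X"
      by (simp add: u_def)
    ultimately have "u \<in> X \<rightarrow>\<^sub>E X"
      by (simp add: PiE_def)
    then have "u \<in> T_Estar X (block_rel I P)"
      using E by (simp add: T_Estar_def trans_monoid_def)
    moreover have "bij_betw u X X"
      unfolding bij_betw_def
    proof (intro conjI inj_onI equalityI subsetI)
      fix x y assume xy: "x \<in> X" "y \<in> X" "u x = u y"
      obtain i j where ij: "i \<in> I" "x \<in> P (c i)" "j \<in> I" "y \<in> P (c j)"
        using cover xy by blast
      \<comment> \<open>Equal values lie in one block, so both arguments come from the same
        \<open>P (c i)\<close>, where \<open>u\<close> is the injective map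
        \<open>h i\<close>.\<close>
      then have "i = j"
        using indexed_partition_unique[OF P ij(1,3), of "u x"] uP xy by metis
      then show "x = y"
        using inj_onD[OF bij_betw_imp_inj_on[OF h[OF ij(1)]], of x y] xy(3) ij u by metis
    next
      fix y assume "y \<in> u ` X"
      then show "y \<in> X"
        using uX by blast
    next
      fix x assume "x \<in> X"
      then obtain i where i: "i \<in> I" "x \<in> P i"
        using X by blast
      then obtain y where y: "y \<in> P (c i)" "x = h i y"
        using h[OF i(1)] by (auto simp: bij_betw_def)
      moreover have "y \<in> X"
        using y cI[OF i(1)] X by blast
      ultimately show "x \<in> u ` X"
        using u[OF i(1)] by (metis imageI)
    qed
    moreover have "f (u (f x)) = f x" if x: "x \<in> X" for x
    proof -
      obtain i where i: "i \<in> I" "x \<in> P i"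
        using x X by blast
      then show ?thesis
        using u[OF i(1) fP[OF i]] fhf[OF i] by simp
    qed
    ultimately show ?L
      unfolding unit_regular_T_Estar_iff[OF f] by blast
  qed
qed

section \<open>Collapse and defect on each block\<close>

theorem proposition5p6:
  fixes X :: "'a set" and I :: "'i set" and P :: "'i \<Rightarrow> 'a set" and f :: "'a \<Rightarrow> 'a"
  assumes "X \<noteq> {}"
    and "indexed_partition X I P"
    and "f \<in> T_Estar X (block_rel I P)"
  shows "unit_regular (T_Estar_monoid X (block_rel I P)) f \<longleftrightarrow>
    character I P f \<in> surj_maps I \<and>
    (\<forall>i\<in>I. \<forall>j\<in>I. character I P f i = j \<longrightarrow>
      |P i| =o |P j| \<and>
      collapse (P i) (block_map P f i) =o defect (P i) (P j) (block_map P f i))"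
proof -
  let ?c = "character I P f"
  have cI: "?c i \<in> I" if "i \<in> I" for i
    using character_props(1)[OF assms(2,3)] that by blast
  have block: "(\<exists>u. bij_betw u (P (?c i)) (P i) \<and> (\<forall>x\<in>P i. f (u (f x)) = f x)) \<longleftrightarrow>
      |P i| =o |P (?c i)| \<and>
      collapse (P i) (block_map P f i) =o defect (P i) (P (?c i)) (block_map P f i)"
    if i: "i \<in> I" for i
  proof -
    let ?h = "block_map P f i"
    have fP: "f x \<in> P (?c i)" if "x \<in> P i" for x
      by (rule character_props(3)[OF assms(2,3) i that])
    then have "?h ` P i \<subseteq> P (?c i)"
      by (auto simp: block_map_def)
    note iff = bij_generalized_inverse_iff_collapse_eq_defect[OF this]
    \<comment> \<open>The map \<open>block_map P f i\<close> agrees with \<open>f\<close> only on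
      \<open>P i\<close>; the bijection \<open>u\<close> returns values of \<open>f\<close> on
      \<open>P i\<close> to \<open>P i\<close>, so the outer application may be replaced
      too.\<close>
    have eq: "(\<forall>x\<in>P i. ?h (u (?h x)) = ?h x) \<longleftrightarrow> (\<forall>x\<in>P i. f (u (f x)) = f x)"
      if "bij_betw u (P (?c i)) (P i)" for u
      using bij_betwE[OF that] fP by (simp add: block_map_def)
    \<comment> \<open>The cardinality condition is read off from the bijection \<open>u\<close>
      itself; the condition on collapse and defect is the criterion for single maps.\<close>
    have "|P i| =o |P (?c i)|" if "bij_betw u (P (?c i)) (P i)" for u
      using card_of_ordIsoI[OF that] by (rule ordIso_symmetric)
    then show ?thesis
      unfolding iff[symmetric] using eq by blast
  qed
  show ?thesis
    unfolding unit_regular_T_Estar_iff_blockwise[OF assms(2,3)]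
    using block cI by simp
qed

end
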